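(* Let $d\ge 2$ be an integer. For $\lambda\in(0,1)$ consider the following equation in the unknown $q>0$: $$\sum_{u=0}^{\infty}\ \prod_{v=1}^{u}\frac{d\lambda}{1+v(d-1)\lambda/q}=\frac{1}{1-\lambda}.\qquad (\ast)$$ The following hold. 1. For every $\lambda\in(0,1)$ there is a unique $q>0$ solving $(\ast)$; denote it by $\mathbb{E}Q$. Moreover, if we set $\mu=(d-1)\lambda/\mathbb{E}Q$, then $$\pi_u=(1-\lambda)\prod_{v=1}^{u}\frac{d\lambda}{1+v\mu},\qquad u\in\mathbb{Z}_+,$$ is an invariant probability distribution for the continuous-time Markov process on $\mathbb{Z}_+$ with transition rates $r_{k,k+1}=d\lambda$ and $r_{k+1,k}=1+(k+1)\mu$ for $k\in\mathbb{Z}_+$ (all other rates being zero), and the mean $\sum_{u\ge 0}u\pi_u$ of $\pi$ is equal to $\mathbb{E}Q$. 2. The solution $\mathbb{E}Q$ of $(\ast)$ satisfies $$\mathbb{E}Q\le\frac{-\log(1-\lambda)}{c_d}\qquad\text{for all }\lambda\in\Bigl(\frac{4d-2}{4d-1},1\Bigr),$$ where $c_d=\frac{2d-3}{2(d-1)}\log\frac{4d}{4d-1}$.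
   Context: $\mathbb{Z}_+=\{0,1,2,\dots\}$. An empty product equals 1. $\log$ is the natural logarithm. *)

theory Defs
  imports "HOL-Probability.Probability"
begin

definition solves_queue_eq :: "nat \<Rightarrow> real \<Rightarrow> real \<Rightarrow> bool" where
  "solves_queue_eq d lam q \<longleftrightarrow>
     q > 0 \<and>
     (\<lambda>u. \<Prod>v=1..u. (real d * lam) / (1 + real v * (real d - 1) * lam / q)) sums (1 / (1 - lam))"

definition queue_dist :: "nat \<Rightarrow> real \<Rightarrow> real \<Rightarrow> nat \<Rightarrow> real" where
  "queue_dist d lam mu u = (1 - lam) * (\<Prod>v=1..u. (real d * lam) / (1 + real v * mu))"

definition queue_rate :: "nat \<Rightarrow> real \<Rightarrow> real \<Rightarrow> nat \<Rightarrow> nat \<Rightarrow> real" where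
  "queue_rate d lam mu k l =
     (if l = k + 1 then real d * lam
      else if k = l + 1 then 1 + real k * mu
      else 0)"

text \<open>
  A continuous-time Markov process on a discrete state space is represented by its
  transition function: \<open>K t i\<close> is the law at time \<open>t\<close> of the process started in \<open>i\<close>,
  a probability distribution, so there is no explosion. Only times \<open>t \<ge> 0\<close> matter.
  The process has transition rates \<open>r\<close> (off-diagonal entries; the diagonal of \<open>r\<close> is
  ignored) if these are its right derivatives at time 0 and the total rate
  out of each state is finite and equal to the sum of the rates.
\<close>

definition markov_semigroup :: "(real \<Rightarrow> 'a \<Rightarrow> 'a pmf) \<Rightarrow> bool" where
  "markov_semigroup K \<longleftrightarrow>
     (\<forall>i. K 0 i = return_pmf i) \<and>
     (\<forall>s\<ge>0. \<forall>t\<ge>0. \<forall>i. K (s + t) i = bind_pmf (K s i) (K t))"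

definition has_transition_rates :: "(real \<Rightarrow> 'a \<Rightarrow> 'a pmf) \<Rightarrow> ('a \<Rightarrow> 'a \<Rightarrow> real) \<Rightarrow> bool" where
  "has_transition_rates K r \<longleftrightarrow>
     (\<forall>i j. i \<noteq> j \<longrightarrow> ((\<lambda>h. pmf (K h i) j / h) \<longlongrightarrow> r i j) (at_right 0)) \<and>
     (\<forall>i. r i summable_on (- {i}) \<and>
          ((\<lambda>h. (1 - pmf (K h i) i) / h) \<longlongrightarrow> infsum (r i) (- {i})) (at_right 0))"

definition markov_process_with_rates ::
    "(real \<Rightarrow> 'a \<Rightarrow> 'a pmf) \<Rightarrow> ('a \<Rightarrow> 'a \<Rightarrow> real) \<Rightarrow> bool" where
  "markov_process_with_rates K r \<longleftrightarrow> markov_semigroup K \<and> has_transition_rates K r"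

definition invariant_distribution :: "(real \<Rightarrow> 'a \<Rightarrow> 'a pmf) \<Rightarrow> 'a pmf \<Rightarrow> bool" where
  "invariant_distribution K p \<longleftrightarrow> (\<forall>t\<ge>0. bind_pmf p (K t) = p)"

definition c_const :: "nat \<Rightarrow> real" where
  "c_const d = (2 * real d - 3) / (2 * (real d - 1)) * ln (4 * real d / (4 * real d - 1))"

end

theory Submission
  imports Defs
begin

text \<open>
  With \<open>\<mu> = (d - 1) \<lambda> / q\<close> the equation reads \<open>F \<mu> = 1 / (1 - \<lambda>)\<close> for a series \<open>F\<close> that is
  continuous and strictly decreasing on the positive reals; it is at most \<open>1 / (1 - \<lambda>)\<close> at
  \<open>\<mu> = d - 1\<close>, by comparison with the geometric series in \<open>\<lambda>\<close>, and at least that for small \<open>\<mu>\<close>.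
  Summing the detailed balance equations gives the mean.

  For invariance, the \<open>n\<close>-step estimate \<open>\<bar>\<pi> K t - \<pi>\<bar> \<le> n * \<bar>\<pi> K (t / n) - \<pi>\<bar>\<close>, valid for any
  transition function \<open>K\<close>, reduces the claim to a first-order expansion at time 0. The error of
  that expansion at state \<open>i\<close> is dominated by three times the exit rate of \<open>i\<close>, which is
  \<open>\<pi>\<close>-integrable, so neither uniqueness of \<open>K\<close> nor the Kolmogorov equations are needed.

  For the upper bound put \<open>\<rho> = 4d / (4d - 1)\<close> and \<open>U = (2d - 3) q / (2 (d - 1))\<close>, so that
  \<open>c\<^sub>d q = U ln \<rho>\<close>. The first \<open>n = \<lfloor>U\<rfloor>\<close> factors of the products are at least \<open>\<rho>\<close>, hence for
  \<open>n > 0\<close> the series is at least \<open>\<rho> ^ (n - 1) + \<rho> ^ n \<ge> \<rho> ^ (n + 1) \<ge> \<rho> powr U\<close>.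
\<close>

subsection \<open>The series\<close>

text \<open>The terms of the series with \<open>a\<close> for d * lam, and also the unnormalised
  stationary weights. The parameter is \<open>mu\<close> rather than q because every factor is
  monotone in \<open>mu\<close>.\<close>

definition weight :: "real \<Rightarrow> real \<Rightarrow> nat \<Rightarrow> real" where
  "weight a mu u = (\<Prod>v=1..u. a / (1 + real v * mu))"

lemma weight_0 [simp]: "weight a mu 0 = 1"
  by (simp add: weight_def)

lemma weight_Suc: "weight a mu (Suc u) = a / (1 + real (Suc u) * mu) * weight a mu u"
  by (simp add: weight_def mult.commute)

lemma weight_balance:
  assumes "0 < mu"
  shows "(1 + real (Suc u) * mu) * weight a mu (Suc u) = a * weight a mu u"
proof -
  have "1 + real (Suc u) * mu > 0"
    using assms by (intro add_pos_nonneg) auto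
  then show ?thesis
    by (simp add: weight_Suc)
qed

lemma weight_pos:
  assumes "0 < a" "0 < mu"
  shows "0 < weight a mu u"
  unfolding weight_def using assms by (intro prod_pos) (auto intro!: divide_pos_pos add_pos_nonneg)

lemma weight_antimono:
  assumes "0 < a" "0 < mu" "mu \<le> mu'"
  shows "weight a mu' u \<le> weight a mu u"
  unfolding weight_def
proof (intro prod_mono conjI)
  fix v assume "v \<in> {1..u}"
  show "0 \<le> a / (1 + real v * mu')"
    using assms by (intro divide_nonneg_nonneg) auto
  show "a / (1 + real v * mu') \<le> a / (1 + real v * mu)"
    using assms by (intro divide_left_mono mult_pos_pos add_pos_nonneg add_left_mono mult_left_mono) auto
qed

text \<open>The factors decrease in v, so the first one bounds them all; for
  \<open>a = d * lam\<close> and \<open>mu = d - 1\<close> it equals \<open>lam\<close>.\<close>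

lemma weight_le_power:
  assumes "0 < a" "0 < mu"
  shows "weight a mu u \<le> (a / (1 + mu)) ^ u"
proof -
  have "weight a mu u \<le> (\<Prod>v=1..u. a / (1 + mu))"
    unfolding weight_def
  proof (intro prod_mono conjI)
    fix v assume "v \<in> {1..u}"
    then have "1 * mu \<le> real v * mu"
      using assms by (intro mult_right_mono) auto
    then show "a / (1 + real v * mu) \<le> a / (1 + mu)"
      using assms by (intro divide_left_mono mult_pos_pos add_pos_nonneg) auto
    show "0 \<le> a / (1 + real v * mu)"
      using assms by (intro divide_nonneg_nonneg) auto
  qed
  then show ?thesis
    by simp
qed

lemma weight_ge_power:
  assumes "0 \<le> b" "\<And>v. v \<le> u \<Longrightarrow> b \<le> a / (1 + real v * mu)"
  shows "b ^ u \<le> weight a mu u"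
proof -
  have "(\<Prod>v=1..u. b) \<le> weight a mu u"
    unfolding weight_def using assms by (intro prod_mono) auto
  then show ?thesis
    by simp
qed

lemma weight_summable:
  assumes "0 < a" "0 < mu"
  shows "summable (weight a mu)"
proof -
  \<comment> \<open>Beyond N one has v * mu > 2 * a, so consecutive ratios are at most 1/2.\<close>
  obtain N where N: "2 * a / mu < real N"
    using reals_Archimedean2 by blast
  show ?thesis
  proof (rule summable_ratio_test[of "1/2" N])
    fix n assume "N \<le> n"
    then have "2 * a / mu < real (Suc n)"
      using N by simp
    then have "2 * a < real (Suc n) * mu"
      using assms by (simp add: pos_divide_less_eq)
    then have "a / (1 + real (Suc n) * mu) \<le> 1 / 2"
      using assms by (subst pos_divide_le_eq) (auto simp: algebra_simps)
    then have "weight a mu (Suc n) \<le> 1 / 2 * weight a mu n"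
      unfolding weight_Suc using weight_pos[OF assms, of n] by (intro mult_right_mono) auto
    then show "norm (weight a mu (Suc n)) \<le> 1 / 2 * norm (weight a mu n)"
      using weight_pos[OF assms, of n] weight_pos[OF assms, of "Suc n"] by simp
  qed simp
qed

text \<open>Detailed balance writes \<open>mu * (u + 1) * weight a mu (u + 1)\<close> as
  \<open>a * weight a mu u - weight a mu (u + 1)\<close>, which is then summed over u. The inner
  \<open>- 1\<close> removes the term u = 0 from the shifted series.\<close>

lemma weight_mean_sums:
  assumes "0 < a" "0 < mu"
  shows "(\<lambda>u. real u * weight a mu u) sums ((a * suminf (weight a mu) - (suminf (weight a mu) - 1)) / mu)"
proof -
  have s: "weight a mu sums suminf (weight a mu)"
    using weight_summable[OF assms] by blast
  then have s': "(\<lambda>u. weight a mu (Suc u)) sums (suminf (weight a mu) - 1)"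
    by (simp add: sums_Suc_iff)
  have "(\<lambda>u. (a * weight a mu u - weight a mu (Suc u)) / mu) sums
      ((a * suminf (weight a mu) - (suminf (weight a mu) - 1)) / mu)"
    by (intro sums_divide sums_diff sums_mult s s')
  also have "(\<lambda>u. (a * weight a mu u - weight a mu (Suc u)) / mu)
      = (\<lambda>u. real (Suc u) * weight a mu (Suc u))"
    unfolding weight_balance[OF assms(2), symmetric] using assms by (simp add: fun_eq_iff field_simps)
  finally show ?thesis
    by (subst (asm) sums_Suc_iff) simp
qed

lemma suminf_weight_strict_antimono:
  assumes "0 < a" "0 < mu" "mu < mu'"
  shows "suminf (weight a mu') < suminf (weight a mu)"
proof -
  have s: "summable (weight a mu)" "summable (weight a mu')"
    using assms by (auto intro: weight_summable)
  have "0 < (\<Sum>u. weight a mu u - weight a mu' u)"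
  \<comment> \<open>Both series start with the term 1, so strictness first appears at index
    1.\<close>
  proof (rule suminf_pos2[where i=1])
    show "summable (\<lambda>u. weight a mu u - weight a mu' u)"
      by (intro summable_diff s)
    show "0 \<le> weight a mu n - weight a mu' n" for n
      using weight_antimono[of a mu mu' n] assms by simp
    show "0 < weight a mu 1 - weight a mu' 1"
      using assms by (auto simp: weight_def intro!: divide_strict_left_mono)
  qed
  then show ?thesis
    using suminf_diff[OF s] by simp
qed

text \<open>The weights at the left endpoint \<open>m\<close> dominate those on the whole interval,
  and positivity of \<open>m\<close> makes them summable for every \<open>a\<close>; so the partial
  sums converge uniformly.\<close>

lemma continuous_on_suminf_weight:
  assumes "0 < a" "0 < m"
  shows "continuous_on {m..m'} (\<lambda>mu. suminf (weight a mu))"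
proof (rule uniform_limit_theorem)
  show "uniform_limit {m..m'} (\<lambda>n mu. \<Sum>u<n. weight a mu u) (\<lambda>mu. suminf (weight a mu)) sequentially"
  proof (rule Weierstrass_m_test)
    show "norm (weight a mu n) \<le> weight a m n" if "mu \<in> {m..m'}" for n mu
      using that assms weight_antimono[of a m mu n] weight_pos[of a mu n] by auto
    show "summable (weight a m)"
      using assms by (rule weight_summable)
  qed
  have "1 + real v * x \<noteq> 0" if "x \<in> {m..m'}" for v x
  proof -
    have "0 < 1 + real v * x"
      using that assms by (intro add_pos_nonneg) auto
    then show ?thesis by simp
  qed
  then show "\<forall>\<^sub>F n in sequentially. continuous_on {m..m'} (\<lambda>mu. \<Sum>u<n. weight a mu u)"
    unfolding weight_def by (intro always_eventually allI continuous_intros) auto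
qed simp

section \<open>Existence and uniqueness of the solution\<close>

lemma exists_suminf_weight_eq:
  assumes d: "2 \<le> d" and lam: "0 < lam" "lam < 1"
  shows "\<exists>mu>0. suminf (weight (d * lam) mu) = 1 / (1 - lam)"
proof -
  define a where "a = d * lam"
  have a: "0 < a" "2 * lam \<le> a"
    using d lam by (auto simp: a_def)
  \<comment> \<open>Any \<open>b\<close> strictly between \<open>lam\<close> and \<open>a\<close> would do: its geometric series exceeds \<open>1 / (1 - lam)\<close>.\<close>
  define b where "b = 3 / 2 * lam"
  \<comment> \<open>Bounded partial sums would force b < 1 and the limit 1 / (1 - b), which exceeds
    1 / (1 - lam) because lam < b. This avoids a case split on b < 1.\<close>
  have "\<exists>N. 1 / (1 - lam) \<le> (\<Sum>u<N. b ^ u)"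
  proof (rule ccontr)
    assume "\<not> ?thesis"
    then have le: "(\<Sum>u<N. b ^ u) \<le> 1 / (1 - lam)" for N
      by (meson less_imp_le not_le)
    have "0 \<le> b"
      using lam by (simp add: b_def)
    with le have sm: "summable (\<lambda>u. b ^ u)"
      by (intro summableI_nonneg_bounded) auto
    then have b1: "b < 1"
      using \<open>0 \<le> b\<close> summable_geometric_iff[of b] by simp
    have "(\<Sum>u. b ^ u) \<le> 1 / (1 - lam)"
      by (rule suminf_le_const[OF sm le])
    then have "1 / (1 - b) \<le> 1 / (1 - lam)"
      using b1 \<open>0 \<le> b\<close> by (simp add: suminf_geometric)
    moreover have "1 / (1 - lam) < 1 / (1 - b)"
      using b1 lam by (intro divide_strict_left_mono) (auto simp: b_def)
    ultimately show False by simp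
  qed
  then obtain N where N: "1 / (1 - lam) \<le> (\<Sum>u<N. b ^ u)" ..
  \<comment> \<open>For v <= N this gives 1 + v * m <= 4/3, and b * 4/3 = 2 * lam <= a; so each of
    these factors is at least b.\<close>
  define m where "m = 1 / (3 * (real N + 1))"
  have m: "0 < m" "m \<le> 1 / 3"
    by (auto simp: m_def field_simps)
  have "b ^ u \<le> weight a m u" if "u < N" for u
  proof (rule weight_ge_power)
    show "0 \<le> b"
      using lam by (simp add: b_def)
    fix v assume "v \<le> u"
    with that have "real v \<le> real N" by simp
    then have "real v * m \<le> 1 / 3"
      by (simp add: m_def field_simps)
    then have "b * (1 + real v * m) \<le> b * (4 / 3)"
      using lam by (intro mult_left_mono) (auto simp: b_def)
    also have "\<dots> \<le> a"
      using a by (simp add: b_def)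
    finally show "b \<le> a / (1 + real v * m)"
      using m by (subst pos_le_divide_eq) (auto intro: add_pos_nonneg)
  qed
  then have "(\<Sum>u<N. b ^ u) \<le> (\<Sum>u<N. weight a m u)"
    by (intro sum_mono) simp
  also have "\<dots> \<le> suminf (weight a m)"
    using a m weight_pos[of a m] by (intro sum_le_suminf weight_summable) (auto intro: less_imp_le)
  finally have low: "1 / (1 - lam) \<le> suminf (weight a m)"
    using N by simp
  have "a / (1 + (d - 1)) = lam"
    using d by (simp add: a_def)
  then have "weight a (d - 1) u \<le> lam ^ u" for u
    using weight_le_power[of a "d - 1" u] a d by simp
  then have "suminf (weight a (d - 1)) \<le> (\<Sum>u. lam ^ u)"
    using a d lam by (intro suminf_le weight_summable) (auto simp: summable_geometric)
  also have "\<dots> = 1 / (1 - lam)"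
    using lam by (simp add: suminf_geometric)
  finally have high: "suminf (weight a (d - 1)) \<le> 1 / (1 - lam)" .
  have "\<exists>mu\<ge>m. mu \<le> d - 1 \<and> suminf (weight a mu) = 1 / (1 - lam)"
    using IVT2'[OF high low _ continuous_on_suminf_weight[OF a(1) m(1)]] m d by auto
  then show ?thesis
    using m unfolding a_def by (auto intro: less_le_trans)
qed

text \<open>For q > 0 the series always converges, so \<open>suminf\<close> is its true sum and
  \<open>sums\<close> reduces to an equation.\<close>

lemma solves_queue_eq_iff:
  assumes "2 \<le> d" "0 < lam"
  shows "solves_queue_eq d lam q \<longleftrightarrow>
    0 < q \<and> suminf (weight (real d * lam) ((real d - 1) * lam / q)) = 1 / (1 - lam)"
proof -
  have "(\<lambda>u. \<Prod>v=1..u. (real d * lam) / (1 + real v * (real d - 1) * lam / q))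
      = weight (real d * lam) ((real d - 1) * lam / q)"
    by (simp add: weight_def fun_eq_iff mult.assoc)
  moreover have "summable (weight (real d * lam) ((real d - 1) * lam / q))" if "0 < q"
    using assms that by (intro weight_summable) auto
  ultimately show ?thesis
    by (auto simp: solves_queue_eq_def sums_iff)
qed

text \<open>The map from q to \<open>mu\<close> is a bijection of the positive reals, so the unique
  root in \<open>mu\<close> transfers to q.\<close>

lemma ex1_solves_queue_eq:
  assumes "2 \<le> d" "0 < lam" "lam < 1"
  shows "\<exists>!q. solves_queue_eq d lam q"
proof -
  have pos: "0 < (real d - 1) * lam"
    using assms by simp
  have a: "0 < real d * lam"
    using assms by simp
  obtain mu where mu: "0 < mu" "suminf (weight (real d * lam) mu) = 1 / (1 - lam)"
    using exists_suminf_weight_eq[of "real d" lam] assms by auto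
  show ?thesis
  proof (rule ex1I[of _ "(real d - 1) * lam / mu"])
    have "(real d - 1) * lam / ((real d - 1) * lam / mu) = mu"
      using assms by simp
    then show "solves_queue_eq d lam ((real d - 1) * lam / mu)"
      using assms mu pos by (simp add: solves_queue_eq_iff)
  next
    fix q assume "solves_queue_eq d lam q"
    then have q: "0 < q" "suminf (weight (real d * lam) ((real d - 1) * lam / q)) = 1 / (1 - lam)"
      using assms by (auto simp: solves_queue_eq_iff)
    have "0 < (real d - 1) * lam / q"
      using pos q by simp
    then have "(real d - 1) * lam / q = mu"
      using suminf_weight_strict_antimono[OF a, of mu "(real d - 1) * lam / q"]
        suminf_weight_strict_antimono[OF a, of "(real d - 1) * lam / q" mu] mu q
      by (cases "(real d - 1) * lam / q" mu rule: linorder_cases) auto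
    then show "q = (real d - 1) * lam / mu"
      using q mu by (auto simp: field_simps)
  qed
qed

section \<open>Mean of the stationary distribution\<close>

lemma queue_dist_eq_weight: "queue_dist d lam mu u = (1 - lam) * weight (real d * lam) mu u"
  by (simp add: queue_dist_def weight_def)

lemma queue_dist_mean:
  assumes "2 \<le> d" "0 < lam" "lam < 1" "solves_queue_eq d lam q"
  defines "mu \<equiv> (real d - 1) * lam / q"
  shows "(\<lambda>u. real u * queue_dist d lam mu u) sums q"
proof -
  let ?s = "suminf (weight (real d * lam) mu)"
  have q: "0 < q" "?s = 1 / (1 - lam)"
    using assms by (auto simp: solves_queue_eq_iff)
  then have "0 < mu"
    using assms(1-3) by (simp add: mu_def)
  then have "(\<lambda>u. (1 - lam) * (real u * weight (real d * lam) mu u)) sums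
      ((1 - lam) * ((real d * lam * ?s - (?s - 1)) / mu))"
    using assms(1,2) by (intro sums_mult weight_mean_sums) auto
  \<comment> \<open>Regrouped so that \<open>(1 - lam) * ?s = 1\<close> applies; the numerator
    becomes d * lam - lam.\<close>
  also have "(1 - lam) * ((real d * lam * ?s - (?s - 1)) / mu)
      = (real d * lam * ((1 - lam) * ?s) - ((1 - lam) * ?s - (1 - lam))) / mu"
    by (simp add: algebra_simps)
  also have "\<dots> = (real d - 1) * lam / mu"
    using assms(3) q by (simp add: algebra_simps)
  also have "\<dots> = q"
    using assms(1,2) q by (simp add: mu_def)
  finally show ?thesis
    by (simp add: queue_dist_eq_weight mult_ac)
qed

section \<open>Upper bound on the solution\<close>

lemma solves_queue_eq_upper_bound:
  assumes d: "2 \<le> d" and lam: "(4 * real d - 2) / (4 * real d - 1) < lam" "lam < 1"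
    and q: "solves_queue_eq d lam q"
  shows "q \<le> - ln (1 - lam) / c_const d"
proof -
  define r where "r = 4 * real d / (4 * real d - 1)"
  define U where "U = (2 * real d - 3) / (2 * (real d - 1)) * q"
  define n where "n = nat \<lfloor>U\<rfloor>"
  define mu where "mu = (real d - 1) * lam / q"
  let ?w = "weight (real d * lam) mu"
  have d': "real d \<ge> 2"
    using d by simp
  have "4 / 5 \<le> (4 * real d - 2) / (4 * real d - 1)"
    using d' by (simp add: field_simps)
  with lam(1) have l45: "4 / 5 < lam"
    by (rule le_less_trans[rotated])
  have q0: "0 < q" and F: "suminf ?w = 1 / (1 - lam)"
    using q d l45 by (auto simp: solves_queue_eq_iff mu_def)
  have mu: "0 < mu"
    using d' l45 q0 by (simp add: mu_def)
  have a: "0 < real d * lam"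
    using d' l45 by simp
  have r: "1 < r" "r \<le> 8 / 7"
    using d' by (auto simp: r_def field_simps)
  have U0: "0 \<le> U"
    using d' q0 by (simp add: U_def)
  have n: "real n \<le> U" "U < real n + 1"
    using U0 by (auto simp: n_def)
  have pw: "r ^ u \<le> ?w u" if "u \<le> n" for u
  proof (rule weight_ge_power)
    fix v assume "v \<le> u"
    with that n have "real v \<le> U" by linarith
    then have "real v * mu \<le> U * mu"
      using mu by (intro mult_right_mono) auto
    also have "\<dots> = (2 * real d - 3) * lam / 2"
      using d' q0 by (simp add: U_def mu_def field_simps)
    \<comment> \<open>Equivalent to lam >= 4/5; the lower bound on \<open>lam\<close> is at least
      6/7 for d >= 2.\<close>
    also have "\<dots> \<le> lam * (4 * real d - 1) / 4 - 1"
      using l45 by (simp add: field_simps)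
    finally have "1 + real v * mu \<le> lam * (4 * real d - 1) / 4"
      by simp
    then have "r * (1 + real v * mu) \<le> r * (lam * (4 * real d - 1) / 4)"
      using r by (intro mult_left_mono) auto
    also have "\<dots> = real d * lam"
      using d' by (simp add: r_def)
    finally show "r \<le> real d * lam / (1 + real v * mu)"
      using mu by (subst pos_le_divide_eq) (auto intro: add_pos_nonneg)
  qed (use r in auto)
  \<comment> \<open>The exponent is n + 1 because U may exceed its integer part n.\<close>
  have "r ^ Suc n \<le> 1 / (1 - lam)"
  proof (cases n)
    case 0
    \<comment> \<open>Here the bound comes from the hypothesis on \<open>lam\<close> alone, which
      says 1 / (1 - lam) > 4 * d - 1.\<close>
    have "r \<le> 4 * real d - 1"
      using r d' by simp
    also have "\<dots> \<le> 1 / (1 - lam)"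
      using lam d' by (simp add: field_simps)
    finally show ?thesis
      using 0 by simp
  next
    case (Suc k)
    \<comment> \<open>8/7 is the value of r at d = 2, its largest. Since r * r <= r + 1, the terms
      at n - 1 and n together reach r ^ (n + 1).\<close>
    have "r * r \<le> 8 / 7 * (8 / 7)"
      using r by (intro mult_mono) auto
    then have "r * r \<le> r + 1"
      using r by simp
    then have "r ^ k * (r * r) \<le> r ^ k * (r + 1)"
      using r by (intro mult_left_mono) auto
    also have "\<dots> = r ^ k + r ^ n"
      by (simp add: Suc algebra_simps)
    also have "\<dots> \<le> ?w k + ?w n"
      using pw[of k] pw[of n] Suc by simp
    also have "\<dots> = sum ?w {k, n}"
      using Suc by simp
    also have "\<dots> \<le> suminf ?w"
      using a mu weight_pos[OF a mu] by (intro sum_le_suminf weight_summable) (auto intro: less_imp_le)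
    finally show ?thesis
      using F Suc by (simp add: mult_ac)
  qed
  then have "ln (r ^ Suc n) \<le> ln (1 / (1 - lam))"
    using r lam by (subst ln_le_cancel_iff) auto
  then have "(real n + 1) * ln r \<le> - ln (1 - lam)"
    using r lam by (simp only: ln_realpow ln_div) (simp add: algebra_simps ln_realpow ln_div)
  moreover have "U * ln r \<le> (real n + 1) * ln r"
    using n r by (intro mult_right_mono) auto
  moreover have "U * ln r = q * c_const d"
    by (simp add: U_def c_const_def r_def)
  moreover have "0 < c_const d"
    using d' r by (simp add: c_const_def r_def[symmetric])
  ultimately show ?thesis
    by (subst pos_le_divide_eq) linarith+
qed

subsection \<open>Invariant distributions from rates\<close>

lemma integrable_pmf_bounded:
  fixes g :: "'a \<Rightarrow> real"
  assumes "\<And>x. \<bar>g x\<bar> \<le> B"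
  shows "integrable (measure_pmf p) g"
  using assms by (intro measure_pmf.integrable_const_bound[where B=B]) auto

text \<open>Being in i at every one of the n grid times is one way to be in i at time n * h.\<close>

lemma markov_semigroup_diagonal_power:
  assumes "markov_semigroup K" "0 \<le> h"
  shows "pmf (K h i) i ^ n \<le> pmf (K (real n * h) i) i"
proof (induction n)
  case 0
  then show ?case
    using assms by (simp add: markov_semigroup_def)
next
  case (Suc n)
  have "pmf (K h i) i ^ Suc n \<le> pmf (K h i) i * pmf (K (real n * h) i) i"
    using Suc by (auto intro: mult_left_mono)
  also have "\<dots> = (\<integral>k. pmf (K (real n * h) k) i * indicator {i} k \<partial>measure_pmf (K h i))"
    by (subst integral_measure_pmf[where A="{i}"]) (auto simp: indicator_def split: if_splits)
  also have "\<dots> \<le> (\<integral>k. pmf (K (real n * h) k) i \<partial>measure_pmf (K h i))"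
    by (intro integral_mono integrable_pmf_bounded[where B=1])
       (auto simp: pmf_le_1 abs_mult indicator_def)
  also have "\<dots> = pmf (K (h + real n * h) i) i"
    using assms by (simp add: markov_semigroup_def pmf_bind)
  finally show ?case
    by (simp add: algebra_simps)
qed

text \<open>Step lengths for refining a time interval; \<open>Suc\<close> keeps them positive, since
  t / 0 = 0 does not lie to the right of 0.\<close>

lemma filterlim_divide_real_at_right_0:
  assumes "0 < (t::real)"
  shows "filterlim (\<lambda>n. t / real (Suc n)) (at_right 0) sequentially"
  unfolding filterlim_at
proof
  show "\<forall>\<^sub>F n in sequentially. t / real (Suc n) \<in> {0<..} \<and> t / real (Suc n) \<noteq> 0"
    using assms by (intro always_eventually) auto
  have "(\<lambda>n. t / real n) \<longlonglongrightarrow> 0"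
    by (rule lim_const_over_n)
  then show "(\<lambda>n. t / real (Suc n)) \<longlonglongrightarrow> 0"
    by (rule LIMSEQ_Suc)
qed

text \<open>\<open>1 - K\<^sub>i\<^sub>i\<close> is subadditive in time, so its difference quotients lie below their limit at 0.\<close>

lemma markov_semigroup_exit_bound:
  assumes K: "markov_semigroup K" and h: "0 < h"
    and lim: "((\<lambda>h. (1 - pmf (K h i) i) / h) \<longlongrightarrow> q) (at_right 0)"
  shows "(1 - pmf (K h i) i) / h \<le> q"
proof (rule tendsto_lowerbound)
  show "(\<lambda>n. (1 - pmf (K (h / real (Suc n)) i) i) / (h / real (Suc n))) \<longlonglongrightarrow> q"
    using filterlim_compose[OF lim filterlim_divide_real_at_right_0[OF h]] .
  have "(1 - pmf (K h i) i) / h \<le> (1 - pmf (K (h / real (Suc n)) i) i) / (h / real (Suc n))" for n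
  proof -
    define x where "x = pmf (K (h / real (Suc n)) i) i"
    \<comment> \<open>Bernoulli turns the power bound on the diagonal into subadditivity of the exit
      probability over n + 1 equal steps.\<close>
    have "1 + of_nat (Suc n) * (x - 1) \<le> (1 + (x - 1)) ^ Suc n"
      by (rule Bernoulli_inequality) (simp add: x_def)
    also have "\<dots> \<le> pmf (K h i) i"
      using markov_semigroup_diagonal_power[OF K, of "h / real (Suc n)" i "Suc n"] h
      by (simp add: x_def del: power_Suc of_nat_Suc)
    finally have "1 - pmf (K h i) i \<le> real (Suc n) * (1 - x)"
      by (simp add: algebra_simps)
    then have "(1 - pmf (K h i) i) / h \<le> real (Suc n) * (1 - x) / h"
      using h by (intro divide_right_mono) auto
    then show ?thesis
      by (simp add: x_def mult.commute)
  qed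
  then show "\<forall>\<^sub>F n in sequentially. (1 - pmf (K h i) i) / h
      \<le> (1 - pmf (K (h / real (Suc n)) i) i) / (h / real (Suc n))"
    by (intro always_eventually allI)
qed simp

text \<open>The right-hand side does not depend on \<open>g\<close>; this makes one error estimate serve every time step.\<close>

lemma pmf_increment_bound:
  fixes g :: "'a \<Rightarrow> real" and P :: "'a pmf"
  assumes h: "0 < h" and N: "finite N" "i \<notin> N" and g: "\<And>j. 0 \<le> g j" "\<And>j. g j \<le> 1"
  shows "\<bar>(\<integral>j. g j \<partial>measure_pmf P) - g i - h * (\<Sum>j\<in>N. r j * (g j - g i))\<bar>
    \<le> h * ((\<Sum>j\<in>N. \<bar>pmf P j / h - r j\<bar>) + (1 - pmf P i - (\<Sum>j\<in>N. pmf P j)) / h)"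
proof -
  let ?A = "insert i N"
  have gd: "\<bar>g j - g i\<bar> \<le> 1" for j
    using g[of j] g[of i] by linarith
  have "(\<integral>j. g j \<partial>measure_pmf P) - g i = (\<integral>j. g j - g i \<partial>measure_pmf P)"
    using g by (subst Bochner_Integration.integral_diff) (auto intro!: integrable_pmf_bounded[where B=1])
  \<comment> \<open>Jumps into N are compared with the rates; jumps outside \<open>?A\<close>
    contribute at most their probability, because g varies by at most 1.\<close>
  also have "\<dots> = (\<integral>j. (g j - g i) * indicator ?A j + (g j - g i) * indicator (- ?A) j \<partial>measure_pmf P)"
    by (intro Bochner_Integration.integral_cong) (auto simp: indicator_def)
  also have "\<dots> = (\<integral>j. (g j - g i) * indicator ?A j \<partial>measure_pmf P)
      + (\<integral>j. (g j - g i) * indicator (- ?A) j \<partial>measure_pmf P)"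
    using gd by (intro Bochner_Integration.integral_add integrable_pmf_bounded[where B=1])
      (auto simp: indicator_def)
  also have "(\<integral>j. (g j - g i) * indicator ?A j \<partial>measure_pmf P) = (\<Sum>j\<in>?A. pmf P j * (g j - g i))"
    using N by (subst integral_measure_pmf[where A="?A"]) (auto simp: indicator_def split: if_splits intro!: sum.cong)
  also have "\<dots> = (\<Sum>j\<in>N. pmf P j * (g j - g i))"
    using N by simp
  finally have eq: "(\<integral>j. g j \<partial>measure_pmf P) - g i - h * (\<Sum>j\<in>N. r j * (g j - g i))
    = (\<Sum>j\<in>N. (pmf P j - h * r j) * (g j - g i)) + (\<integral>j. (g j - g i) * indicator (- ?A) j \<partial>measure_pmf P)"
    by (simp add: sum_distrib_left left_diff_distrib sum_subtractf mult.assoc)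
  have "\<bar>\<Sum>j\<in>N. (pmf P j - h * r j) * (g j - g i)\<bar> \<le> (\<Sum>j\<in>N. \<bar>(pmf P j - h * r j) * (g j - g i)\<bar>)"
    by (rule sum_abs)
  also have "\<dots> \<le> (\<Sum>j\<in>N. h * \<bar>pmf P j / h - r j\<bar>)"
  proof (rule sum_mono)
    fix j
    have "\<bar>(pmf P j - h * r j) * (g j - g i)\<bar> \<le> \<bar>pmf P j - h * r j\<bar>"
      using gd[of j] by (simp add: abs_mult mult_left_le)
    also have "\<dots> = \<bar>h * (pmf P j / h - r j)\<bar>"
      using h by (simp add: right_diff_distrib)
    also have "\<dots> = h * \<bar>pmf P j / h - r j\<bar>"
      using h by (simp add: abs_mult)
    finally show "\<bar>(pmf P j - h * r j) * (g j - g i)\<bar> \<le> h * \<bar>pmf P j / h - r j\<bar>" .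
  qed
  finally have 1: "\<bar>\<Sum>j\<in>N. (pmf P j - h * r j) * (g j - g i)\<bar> \<le> h * (\<Sum>j\<in>N. \<bar>pmf P j / h - r j\<bar>)"
    by (simp add: sum_distrib_left)
  have "\<bar>\<integral>j. (g j - g i) * indicator (- ?A) j \<partial>measure_pmf P\<bar>
      \<le> (\<integral>j. \<bar>(g j - g i) * indicator (- ?A) j\<bar> \<partial>measure_pmf P)"
    by (rule integral_abs_bound)
  also have "\<dots> \<le> (\<integral>j. indicator (- ?A) j \<partial>measure_pmf P)"
    using gd by (intro integral_mono integrable_pmf_bounded[where B=1]) (auto simp: indicator_def)
  also have "\<dots> = measure (measure_pmf P) (- ?A)"
    by simp
  also have "\<dots> = 1 - measure (measure_pmf P) ?A"
    using measure_pmf.prob_compl[of ?A P] by (simp add: Compl_eq_Diff_UNIV)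
  also have "\<dots> = 1 - pmf P i - (\<Sum>j\<in>N. pmf P j)"
    using N by (simp add: measure_measure_pmf_finite)
  finally show ?thesis
    unfolding eq using 1 h by (simp add: distrib_left)
qed

text \<open>\<open>gen\<close> is stationarity tested on functions with values in [0, 1]. These
  suffice because the proof applies it to transition probabilities \<open>pmf (K s i) x\<close> as
  functions of i.\<close>

lemma invariant_distributionI:
  fixes p :: "'a pmf" and r :: "'a \<Rightarrow> 'a \<Rightarrow> real"
  assumes K: "markov_process_with_rates K r"
    and N: "\<And>i. finite (N i)" "\<And>i. i \<notin> N i" "\<And>i j. j \<notin> N i \<Longrightarrow> j \<noteq> i \<Longrightarrow> r i j = 0"
    and int: "integrable (measure_pmf p) (\<lambda>i. \<Sum>j\<in>N i. r i j)"
    and gen: "\<And>g. (\<And>i. 0 \<le> g i) \<Longrightarrow> (\<And>i. g i \<le> 1) \<Longrightarrow>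
      (\<integral>i. (\<Sum>j\<in>N i. r i j * (g j - g i)) \<partial>measure_pmf p) = 0"
  shows "invariant_distribution K p"
  unfolding invariant_distribution_def
proof (intro allI impI)
  fix t :: real assume "0 \<le> t"
  define q where "q i = (\<Sum>j\<in>N i. r i j)" for i
  \<comment> \<open>The bracket of \<open>pmf_increment_bound\<close> for the law
    \<open>K h i\<close>: \<open>h * e h i\<close> bounds the first-order error at i for all g at
    once.\<close>
  define e where "e h i = (\<Sum>j\<in>N i. \<bar>pmf (K h i) j / h - r i j\<bar>)
      + (1 - pmf (K h i) i - (\<Sum>j\<in>N i. pmf (K h i) j)) / h" for h i
  have K0: "markov_semigroup K"
    and Kr: "\<And>i j. i \<noteq> j \<Longrightarrow> ((\<lambda>h. pmf (K h i) j / h) \<longlongrightarrow> r i j) (at_right 0)"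
    and Kq: "\<And>i. ((\<lambda>h. (1 - pmf (K h i) i) / h) \<longlongrightarrow> infsum (r i) (- {i})) (at_right 0)"
    using K by (auto simp: markov_process_with_rates_def has_transition_rates_def)
  have "infsum (r i) (- {i}) = infsum (r i) (N i)" for i
    using N by (intro infsum_cong_neutral) auto
  with Kq have Kq: "((\<lambda>h. (1 - pmf (K h i) i) / h) \<longlongrightarrow> q i) (at_right 0)" for i
    using N by (simp add: q_def)
  have r_nonneg: "0 \<le> r i j" if "i \<noteq> j" for i j
    using eventually_at_right_less[of "0::real"]
    by (intro tendsto_lowerbound[OF Kr[OF that]]) (auto elim!: eventually_mono)
  then have rN: "0 \<le> r i j" if "j \<in> N i" for i j
    using that N(2) by metis
  have N': "(\<Sum>j\<in>N i. pmf P j) \<le> 1 - pmf P i" for i and P :: "'a pmf"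
  proof -
    have "measure (measure_pmf P) (insert i (N i)) \<le> 1"
      by simp
    then show ?thesis
      using N by (simp add: measure_measure_pmf_finite)
  qed
  have e_nonneg: "0 \<le> e h i" if "0 < h" for h i
    unfolding e_def using N'[where i=i] that by (intro add_nonneg_nonneg sum_nonneg) auto
  \<comment> \<open>Transition quotients and rates each add up to at most one exit rate; the escape
    term contributes the third.\<close>
  have e_le: "e h i \<le> 3 * q i" if "0 < h" for h i
  proof -
    have 1: "(1 - pmf (K h i) i) / h \<le> q i"
      by (rule markov_semigroup_exit_bound[OF K0 that Kq])
    have "(\<Sum>j\<in>N i. \<bar>pmf (K h i) j / h - r i j\<bar>) \<le> (\<Sum>j\<in>N i. pmf (K h i) j / h + r i j)"
      using that rN by (intro sum_mono) (auto simp: abs_le_iff intro: add_increasing add_increasing2)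
    also have "\<dots> = (\<Sum>j\<in>N i. pmf (K h i) j) / h + q i"
      by (simp add: sum.distrib q_def sum_divide_distrib)
    also have "\<dots> \<le> (1 - pmf (K h i) i) / h + q i"
      using that N' by (intro add_right_mono divide_right_mono) auto
    finally have 2: "(\<Sum>j\<in>N i. \<bar>pmf (K h i) j / h - r i j\<bar>) \<le> 2 * q i"
      using 1 by simp
    have "(1 - pmf (K h i) i - (\<Sum>j\<in>N i. pmf (K h i) j)) / h \<le> (1 - pmf (K h i) i) / h"
      using that by (intro divide_right_mono) (auto intro: sum_nonneg)
    with 1 2 show ?thesis
      by (simp add: e_def)
  qed
  \<comment> \<open>The escape term tends to the exit rate minus the sum of the rates over
    \<open>N i\<close>, which is 0: the total rate out of i is accounted for by jumps into
    \<open>N i\<close>.\<close>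
  have e_lim: "((\<lambda>h. e h i) \<longlongrightarrow> 0) (at_right 0)" for i
  proof -
    have "((\<lambda>h. (\<Sum>j\<in>N i. \<bar>pmf (K h i) j / h - r i j\<bar>)
        + ((1 - pmf (K h i) i) / h - (\<Sum>j\<in>N i. pmf (K h i) j / h)))
      \<longlongrightarrow> (\<Sum>j\<in>N i. \<bar>r i j - r i j\<bar>) + (q i - (\<Sum>j\<in>N i. r i j))) (at_right 0)"
      using N(2) by (intro tendsto_intros Kr Kq) auto
    then show ?thesis
      by (simp add: e_def q_def diff_divide_distrib sum_divide_distrib)
  qed
  \<comment> \<open>The short step is taken first, starting from p, and the remaining time s enters
    only through g. The bound is therefore free of s and can be added over successive steps.\<close>
  have step: "\<bar>pmf (bind_pmf p (K (h + s))) x - pmf (bind_pmf p (K s)) x\<bar> \<le> h * (\<integral>i. e h i \<partial>measure_pmf p)"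
    if "0 < h" "0 \<le> s" for h s x
  proof -
    define g where "g i = pmf (K s i) x" for i
    define G where "G i = (\<Sum>j\<in>N i. r i j * (g j - g i))" for i
    have g: "0 \<le> g i" "g i \<le> 1" for i
      by (auto simp: g_def pmf_le_1)
    have Ig: "(\<integral>j. g j \<partial>measure_pmf P) \<in> {0..1}" for P :: "'a pmf"
      using pmf_le_1[of "bind_pmf P (K s)" x] by (auto simp: g_def pmf_bind[symmetric])
    have G_le: "\<bar>G i\<bar> \<le> q i" for i
    proof -
      have "\<bar>G i\<bar> \<le> (\<Sum>j\<in>N i. \<bar>r i j * (g j - g i)\<bar>)"
        unfolding G_def by (rule sum_abs)
      also have "\<dots> \<le> (\<Sum>j\<in>N i. r i j)"
      proof (rule sum_mono)
        fix j assume j: "j \<in> N i"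
        have "\<bar>g j - g i\<bar> \<le> 1"
          using g[of i] g[of j] by linarith
        then show "\<bar>r i j * (g j - g i)\<bar> \<le> r i j"
          using rN[OF j] by (simp add: abs_mult mult_left_le)
      qed
      finally show ?thesis by (simp add: q_def)
    qed
    have intq: "integrable (measure_pmf p) q"
      using int by (simp add: q_def[abs_def])
    have intG: "integrable (measure_pmf p) G"
    proof (rule Bochner_Integration.integrable_bound[OF intq])
      show "AE i in measure_pmf p. norm (G i) \<le> norm (q i)"
        using G_le order_trans[OF G_le abs_ge_self] by (intro always_eventually) simp
    qed simp
    have inte: "integrable (measure_pmf p) (e h)"
    proof (rule Bochner_Integration.integrable_bound)
      show "integrable (measure_pmf p) (\<lambda>i. 3 * q i)"
        using intq by simp
      have "norm (e h i) \<le> norm (3 * q i)" for i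
        using e_nonneg[OF that(1), of i] e_le[OF that(1), of i] by simp
      then show "AE i in measure_pmf p. norm (e h i) \<le> norm (3 * q i)"
        by simp
    qed simp
    have intD: "integrable (measure_pmf p) (\<lambda>i. (\<integral>j. g j \<partial>measure_pmf (K h i)) - g i)"
      using Ig g by (intro Bochner_Integration.integrable_diff integrable_pmf_bounded[where B=1]) auto
    have "bind_pmf p (K (h + s)) = bind_pmf p (\<lambda>i. bind_pmf (K h i) (K s))"
      using K0 that by (intro bind_pmf_cong) (auto simp: markov_semigroup_def)
    then have "pmf (bind_pmf p (K (h + s))) x - pmf (bind_pmf p (K s)) x
      = (\<integral>i. (\<integral>j. g j \<partial>measure_pmf (K h i)) \<partial>measure_pmf p) - (\<integral>i. g i \<partial>measure_pmf p)"
      by (simp add: pmf_bind g_def)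
    also have "\<dots> = (\<integral>i. (\<integral>j. g j \<partial>measure_pmf (K h i)) - g i \<partial>measure_pmf p)"
      using Ig g by (intro Bochner_Integration.integral_diff[symmetric] integrable_pmf_bounded[where B=1]) auto
    \<comment> \<open>The subtracted integral vanishes by \<open>gen\<close>.\<close>
    also have "\<dots> = (\<integral>i. (\<integral>j. g j \<partial>measure_pmf (K h i)) - g i \<partial>measure_pmf p) - h * (\<integral>i. G i \<partial>measure_pmf p)"
      using gen[of g] g by (simp add: G_def)
    also have "\<dots> = (\<integral>i. (\<integral>j. g j \<partial>measure_pmf (K h i)) - g i - h * G i \<partial>measure_pmf p)"
      using intG intD by simp
    finally have "\<bar>pmf (bind_pmf p (K (h + s))) x - pmf (bind_pmf p (K s)) x\<bar>
      \<le> (\<integral>i. \<bar>(\<integral>j. g j \<partial>measure_pmf (K h i)) - g i - h * G i\<bar> \<partial>measure_pmf p)"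
      using integral_abs_bound by simp
    also have "\<dots> \<le> (\<integral>i. h * e h i \<partial>measure_pmf p)"
    proof (rule integral_mono)
      show "integrable (measure_pmf p) (\<lambda>i. \<bar>(\<integral>j. g j \<partial>measure_pmf (K h i)) - g i - h * G i\<bar>)"
        by (rule integrable_abs[OF Bochner_Integration.integrable_diff[OF intD integrable_mult_right[OF intG]]])
      show "integrable (measure_pmf p) (\<lambda>i. h * e h i)"
        using inte by simp
      show "\<bar>(\<integral>j. g j \<partial>measure_pmf (K h i)) - g i - h * G i\<bar> \<le> h * e h i" for i
        unfolding G_def e_def by (rule pmf_increment_bound[where g=g, OF that(1) N(1) N(2) g])
    qed
    finally show ?thesis by simp
  qed
  have steps: "\<bar>pmf (bind_pmf p (K (real n * h))) x - pmf p x\<bar> \<le> real n * h * (\<integral>i. e h i \<partial>measure_pmf p)"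
    if "0 < h" for h n x
  proof (induction n)
    case 0
    have "K 0 = return_pmf"
      using K0 by (auto simp: markov_semigroup_def)
    then show ?case
      by (simp add: bind_return_pmf')
  next
    case (Suc n)
    have "real (Suc n) * h = h + real n * h"
      by (simp add: algebra_simps)
    with step[OF that, of "real n * h" x] Suc that show ?case
      by (simp add: algebra_simps)
  qed
  show "bind_pmf p (K t) = p"
  proof (cases "t = 0")
    case True
    have "K 0 = return_pmf"
      using K0 by (auto simp: markov_semigroup_def)
    with True show ?thesis
      by (simp add: bind_return_pmf')
  next
    case False
    with \<open>0 \<le> t\<close> have t: "0 < t" by simp
    let ?h = "\<lambda>n. t / real (Suc n)"
    have h: "0 < ?h n" for n
      using t by simp
    \<comment> \<open>After \<open>Suc n\<close> steps of length \<open>?h n\<close> the total error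
      is at most t times this integral.\<close>
    have "(\<lambda>n. \<integral>i. e (?h n) i \<partial>measure_pmf p) \<longlonglongrightarrow> (\<integral>i. 0 \<partial>measure_pmf p)"
    proof (rule integral_dominated_convergence)
      show "integrable (measure_pmf p) (\<lambda>i. 3 * q i)"
        using int by (simp add: q_def)
      show "AE i in measure_pmf p. (\<lambda>n. e (?h n) i) \<longlonglongrightarrow> 0"
        using filterlim_compose[OF e_lim filterlim_divide_real_at_right_0[OF t]] by simp
      show "AE i in measure_pmf p. norm (e (?h n) i) \<le> 3 * q i" for n
        using e_nonneg[OF h] e_le[OF h] by simp
    qed auto
    then have lim: "(\<lambda>n. t * (\<integral>i. e (?h n) i \<partial>measure_pmf p)) \<longlonglongrightarrow> 0"
      by (auto intro: tendsto_mult_right_zero)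
    show ?thesis
    proof (rule pmf_eqI)
      fix x
      have "\<bar>pmf (bind_pmf p (K t)) x - pmf p x\<bar> \<le> 0"
      proof (rule tendsto_lowerbound[OF lim])
        have "\<bar>pmf (bind_pmf p (K t)) x - pmf p x\<bar> \<le> t * (\<integral>i. e (?h n) i \<partial>measure_pmf p)" for n
          using steps[OF h[of n], of "Suc n" x] by (simp del: of_nat_Suc)
        then show "\<forall>\<^sub>F n in sequentially. \<bar>pmf (bind_pmf p (K t)) x - pmf p x\<bar>
            \<le> t * (\<integral>i. e (?h n) i \<partial>measure_pmf p)"
          by (intro always_eventually allI)
      qed simp
      then show "pmf (bind_pmf p (K t)) x = pmf p x"
        by simp
    qed
  qed
qed

subsection \<open>The stationary queue\<close>

lemma measure_pmf_nat_integrable_iff: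
  fixes f :: "nat \<Rightarrow> real"
  shows "integrable (measure_pmf p) f \<longleftrightarrow> summable (\<lambda>n. \<bar>pmf p n * f n\<bar>)"
  unfolding measure_pmf_eq_density
  by (subst integrable_density) (auto simp: integrable_count_space_nat_iff)

lemma measure_pmf_nat_integral_sums:
  fixes f :: "nat \<Rightarrow> real"
  assumes "summable (\<lambda>n. \<bar>pmf p n * f n\<bar>)"
  shows "(\<lambda>n. pmf p n * f n) sums (\<integral>n. f n \<partial>measure_pmf p)"
proof -
  have "(\<integral>n. f n \<partial>measure_pmf p) = (\<integral>n. pmf p n * f n \<partial>count_space UNIV)"
    unfolding measure_pmf_eq_density by (subst integral_density) auto
  with sums_integral_count_space_nat[of "\<lambda>n. pmf p n * f n"] assms show ?thesis
    by (simp add: integrable_count_space_nat_iff)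
qed

definition queue_neighbours :: "nat \<Rightarrow> nat set" where
  "queue_neighbours i = (if i = 0 then {1} else {i - 1, i + 1})"

text \<open>Taking f = 1 yields the exit rate, and f j = g j - g i yields the generator applied to
  g.\<close>

lemma sum_queue_neighbours:
  "(\<Sum>j\<in>queue_neighbours i. queue_rate d lam mu i j * f j)
    = real d * lam * f (i + 1) + (if i = 0 then 0 else (1 + real i * mu) * f (i - 1))"
  by (cases i) (auto simp: queue_neighbours_def queue_rate_def)

lemma queue_dist_balance:
  assumes "0 < mu"
  shows "queue_dist d lam mu (Suc u) * (1 + real (Suc u) * mu) = real d * lam * queue_dist d lam mu u"
  using weight_balance[OF assms, of u "real d * lam"] by (simp add: queue_dist_eq_weight mult_ac)

text \<open>Detailed balance makes the integral of the generator against the stationary law telescope.\<close>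

lemma queue_generator_sums_0:
  assumes mu: "0 < mu" and lim: "queue_dist d lam mu \<longlonglongrightarrow> 0"
    and g: "\<And>i. 0 \<le> g i" "\<And>i. g i \<le> 1"
  shows "(\<lambda>i. queue_dist d lam mu i *
    (\<Sum>j\<in>queue_neighbours i. queue_rate d lam mu i j * (g j - g i))) sums 0"
proof -
  let ?\<pi> = "queue_dist d lam mu"
  \<comment> \<open>T i is the weighted increment of g across the edge from i to i + 1. S shifts it
    by one, with S 0 = 0 since no edge lies below 0.\<close>
  define T where "T i = real d * lam * ?\<pi> i * (g (Suc i) - g i)" for i
  define S where "S i = (case i of 0 \<Rightarrow> 0 | Suc k \<Rightarrow> T k)" for i
  have "(\<lambda>i. ?\<pi> i * (g (Suc i) - g i)) \<longlonglongrightarrow> 0"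
  proof (rule Lim_null_comparison)
    have "\<bar>g (Suc i) - g i\<bar> \<le> 1" for i
      using g[of i] g[of "Suc i"] by linarith
    then show "\<forall>\<^sub>F i in sequentially. norm (?\<pi> i * (g (Suc i) - g i)) \<le> \<bar>?\<pi> i\<bar>"
      by (intro always_eventually allI) (auto simp: abs_mult mult_left_le)
    show "(\<lambda>i. \<bar>?\<pi> i\<bar>) \<longlonglongrightarrow> 0"
      using lim by (rule tendsto_rabs_zero)
  qed
  then have "T \<longlonglongrightarrow> 0"
    unfolding T_def mult.assoc by (auto intro!: tendsto_mult_right_zero)
  then have "(\<lambda>i. S (Suc i)) \<longlonglongrightarrow> 0"
    by (simp add: S_def)
  then have "S \<longlonglongrightarrow> 0"
    by (simp only: filterlim_sequentially_Suc)
  then have "(\<lambda>i. S (Suc i) - S i) sums (0 - S 0)"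
    by (rule telescope_sums)
  moreover have "S (Suc i) - S i =
      ?\<pi> i * (\<Sum>j\<in>queue_neighbours i. queue_rate d lam mu i j * (g j - g i))" for i
  proof (cases i)
    case 0
    then show ?thesis
      by (simp add: S_def T_def sum_queue_neighbours)
  next
    case (Suc k)
    have generator: "(\<Sum>j\<in>queue_neighbours i. queue_rate d lam mu i j * (g j - g i))
        = real d * lam * (g (Suc i) - g i) + (1 + real i * mu) * (g k - g i)"
      using sum_queue_neighbours[where f="\<lambda>j. g j - g i"] Suc by simp
    have "?\<pi> i * (\<Sum>j\<in>queue_neighbours i. queue_rate d lam mu i j * (g j - g i))
        = T i + ?\<pi> i * (1 + real i * mu) * (g k - g i)"
      unfolding generator by (simp add: T_def algebra_simps)
    \<comment> \<open>Detailed balance trades the downward flow out of i for the upward flow out of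
      k = i - 1.\<close>
    also have "?\<pi> i * (1 + real i * mu) * (g k - g i) = - T k"
      unfolding Suc queue_dist_balance[OF mu] by (simp add: T_def algebra_simps)
    finally show ?thesis
      using Suc by (simp add: S_def)
  qed
  ultimately show ?thesis
    by (simp add: S_def)
qed

lemma queue_dist_invariant:
  assumes d: "2 \<le> d" and lam: "0 < lam" "lam < 1" and q: "solves_queue_eq d lam q"
  defines "mu \<equiv> (real d - 1) * lam / q"
  shows "\<exists>p. pmf p = queue_dist d lam mu \<and>
    (\<forall>K. markov_process_with_rates K (queue_rate d lam mu) \<longrightarrow> invariant_distribution K p)"
proof -
  let ?\<pi> = "queue_dist d lam mu"
  have a: "0 < real d * lam"
    using d lam by simp
  have q': "0 < q" "suminf (weight (real d * lam) mu) = 1 / (1 - lam)"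
    using q d lam by (auto simp: solves_queue_eq_iff mu_def)
  then have mu: "0 < mu"
    using d lam by (simp add: mu_def)
  have pos: "0 \<le> ?\<pi> u" for u
    using weight_pos[OF a mu, of u] lam by (simp add: queue_dist_eq_weight)
  have "weight (real d * lam) mu sums (1 / (1 - lam))"
    using summable_sums[OF weight_summable[OF a mu]] q' by simp
  from sums_mult[OF this, of "1 - lam"] have sums1: "?\<pi> sums 1"
    using lam by (simp add: queue_dist_eq_weight[abs_def])
  have mean: "(\<lambda>u. real u * ?\<pi> u) sums q"
    unfolding mu_def using d lam q by (rule queue_dist_mean)
  define p where "p = embed_pmf ?\<pi>"
  have "(\<integral>\<^sup>+u. ennreal (?\<pi> u) \<partial>count_space UNIV) = 1"
    using sums1 pos by (simp add: nn_integral_count_space_nat suminf_ennreal2 sums_iff)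
  then have p: "pmf p = ?\<pi>"
    unfolding p_def using pos by (intro ext pmf_embed_pmf)
  \<comment> \<open>The exit rate is at most linear in the state, so the finite mean makes it
    integrable.\<close>
  have int: "integrable (measure_pmf p) (\<lambda>i. \<Sum>j\<in>queue_neighbours i. queue_rate d lam mu i j)"
  proof -
    have "summable (\<lambda>i. (real d * lam + 1) * ?\<pi> i + mu * (real i * ?\<pi> i))"
      using sums1 mean by (intro summable_add summable_mult) (auto simp: sums_iff)
    moreover have "(real d * lam + 1) * ?\<pi> i + mu * (real i * ?\<pi> i)
        = \<bar>?\<pi> i * (real d * lam + (1 + real i * mu))\<bar>" for i
    proof -
      have "0 \<le> ?\<pi> i * (real d * lam + (1 + real i * mu))"
        using pos[of i] lam mu by (intro mult_nonneg_nonneg add_nonneg_nonneg) auto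
      then show ?thesis
        by (simp only: abs_of_nonneg) (simp add: algebra_simps)
    qed
    ultimately have "summable (\<lambda>i. \<bar>?\<pi> i * (real d * lam + (1 + real i * mu))\<bar>)"
      by simp
    then have "integrable (measure_pmf p) (\<lambda>i. real d * lam + (1 + real i * mu))"
      by (simp add: measure_pmf_nat_integrable_iff p)
    then show ?thesis
      using a mu sum_queue_neighbours[where f="\<lambda>_. 1"]
      by (elim Bochner_Integration.integrable_bound) auto
  qed
  have "invariant_distribution K p" if K: "markov_process_with_rates K (queue_rate d lam mu)" for K
  proof (rule invariant_distributionI[OF K _ _ _ int])
    show "finite (queue_neighbours i)" "i \<notin> queue_neighbours i" for i
      by (auto simp: queue_neighbours_def)
    show "queue_rate d lam mu i j = 0" if "j \<notin> queue_neighbours i" "j \<noteq> i" for i j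
      using that by (auto simp: queue_neighbours_def queue_rate_def split: if_splits)
    fix g :: "nat \<Rightarrow> real" assume g: "\<And>i. 0 \<le> g i" "\<And>i. g i \<le> 1"
    let ?G = "\<lambda>i. \<Sum>j\<in>queue_neighbours i. queue_rate d lam mu i j * (g j - g i)"
    have r: "0 \<le> queue_rate d lam mu i j" for i j
      using a mu by (simp add: queue_rate_def)
    have G: "\<bar>?G i\<bar> \<le> (\<Sum>j\<in>queue_neighbours i. queue_rate d lam mu i j)" for i
    proof -
      have "\<bar>g j - g i\<bar> \<le> 1" for j
        using g[of i] g[of j] by linarith
      then show ?thesis
        using r by (intro order_trans[OF sum_abs] sum_mono) (simp add: abs_mult mult_left_le)
    qed
    have "integrable (measure_pmf p) ?G"
    proof (rule Bochner_Integration.integrable_bound[OF int])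
      show "AE i in measure_pmf p. norm (?G i) \<le> norm (\<Sum>j\<in>queue_neighbours i. queue_rate d lam mu i j)"
        using order_trans[OF G abs_ge_self] by (intro always_eventually) simp
    qed simp
    then have "(\<lambda>i. ?\<pi> i * ?G i) sums (\<integral>i. ?G i \<partial>measure_pmf p)"
      using measure_pmf_nat_integral_sums[of p ?G] by (simp add: measure_pmf_nat_integrable_iff p)
    moreover have "(\<lambda>i. ?\<pi> i * ?G i) sums 0"
      using sums1 by (intro queue_generator_sums_0 mu g summable_LIMSEQ_zero) (auto simp: sums_iff)
    ultimately show "(\<integral>i. ?G i \<partial>measure_pmf p) = 0"
      by (rule sums_unique2)
  qed
  with p show ?thesis by blast
qed

theorem theorem1:
  fixes d :: nat
  assumes "d \<ge> 2"
  shows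
    "(\<forall>lam::real. 0 < lam \<and> lam < 1 \<longrightarrow>
        (\<exists>!q. solves_queue_eq d lam q) \<and>
        (\<forall>EQ mu. solves_queue_eq d lam EQ \<and> mu = (real d - 1) * lam / EQ \<longrightarrow>
           (\<exists>p. pmf p = queue_dist d lam mu \<and>
                (\<forall>K. markov_process_with_rates K (queue_rate d lam mu)
                     \<longrightarrow> invariant_distribution K p)) \<and>
           (\<lambda>u. real u * queue_dist d lam mu u) sums EQ)) \<and>
     (\<forall>lam EQ. (4 * real d - 2) / (4 * real d - 1) < lam \<and> lam < 1 \<and> solves_queue_eq d lam EQ \<longrightarrow>
        EQ \<le> - ln (1 - lam) / c_const d)"
  using ex1_solves_queue_eq[OF assms] queue_dist_invariant[OF assms] queue_dist_mean[OF assms]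
    solves_queue_eq_upper_bound[OF assms]
  by blast

end
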